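(* Let $\mathbb{F}$ be a field of characteristic zero. All derivations of the Lie algebra $W_X(\mathbb{F})$ are inner; that is, for every derivation $d$ of $W_X(\mathbb{F})$ there exists $a\in W_X(\mathbb{F})$ such that $d(x)=[x,a]$ for all $x\in W_X(\mathbb{F})$.
   Context: Let $X=\{x_1,x_2,\dots\}$ be a countably infinite set of variables and $\mathbb{F}[X]$ the (commutative) polynomial algebra. $W_X(\mathbb{F})=\mathrm{Der}\,\mathbb{F}[X]$ is the Lie algebra (under commutator) of all $\mathbb{F}$-linear derivations of $\mathbb{F}[X]$; its elements are exactly the (possibly infinite) sums $\sum_{i=1}^\infty f_i\frac{\partial}{\partial x_i}$ with $f_i\in\mathbb{F}[X]$. A derivation of a Lie algebra $L$ is an $\mathbb{F}$-linear map $d:L\to L$ with $d([x,y])=[d(x),y]+[x,d(y)]$. *)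

theory Defs
  imports "HOL-Library.Poly_Mapping" "HOL-Library.Function_Algebras"
begin

text \<open>
  The polynomial algebra in the variables \<open>x\<^sub>0, x\<^sub>1, \<dots>\<close>: a monomial is a finitely supported
  exponent function on the variable indices, a polynomial a finitely supported coefficient
  function on the monomials, and the library product on this type is convolution, that is,
  the usual product of polynomials.
\<close>

type_synonym 'k polys = "(nat \<Rightarrow>\<^sub>0 nat) \<Rightarrow>\<^sub>0 'k"

definition poly_scale :: "'k::field \<Rightarrow> 'k polys \<Rightarrow> 'k polys" where
  "poly_scale c p = Poly_Mapping.map ((*) c) p"

text \<open>
  Derivations of a not necessarily associative algebra with carrier \<open>A\<close>, scalar
  multiplication \<open>s\<close> and product \<open>m\<close>. Only the values of \<open>D\<close> on \<open>A\<close> matter. The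
  definition is used both for \<open>\<bbbF>[X]\<close> and for the Lie algebra of its derivations.
\<close>

definition derivation_on ::
    "('k \<Rightarrow> 'v \<Rightarrow> 'v::ab_group_add) \<Rightarrow> ('v \<Rightarrow> 'v \<Rightarrow> 'v) \<Rightarrow> 'v set \<Rightarrow> ('v \<Rightarrow> 'v) \<Rightarrow> bool" where
  "derivation_on s m A D \<longleftrightarrow>
     (\<forall>x\<in>A. D x \<in> A) \<and>
     (\<forall>x\<in>A. \<forall>y\<in>A. D (x + y) = D x + D y) \<and>
     (\<forall>c. \<forall>x\<in>A. D (s c x) = s c (D x)) \<and>
     (\<forall>x\<in>A. \<forall>y\<in>A. D (m x y) = m (D x) y + m x (D y))"

definition W :: "('k::field polys \<Rightarrow> 'k polys) set" where
  "W = {D. derivation_on poly_scale (*) UNIV D}"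

text \<open>
  Addition and subtraction of maps are pointwise; the product of maps from
  \<^theory>\<open>HOL-Library.Function_Algebras\<close> (pointwise, not composition) is not used.
\<close>

definition W_scale :: "'k::field \<Rightarrow> ('k polys \<Rightarrow> 'k polys) \<Rightarrow> 'k polys \<Rightarrow> 'k polys" where
  "W_scale c D = (\<lambda>p. poly_scale c (D p))"

definition W_bracket ::
    "('k::field polys \<Rightarrow> 'k polys) \<Rightarrow> ('k polys \<Rightarrow> 'k polys) \<Rightarrow> 'k polys \<Rightarrow> 'k polys" where
  "W_bracket D E = (D \<circ> E) - (E \<circ> D)"

lemma poly_scale_conv_mult: "poly_scale c p = Poly_Mapping.single 0 c * p"
  by (simp add: poly_scale_def mult_map_scale_conv_mult)

lemma W_iff:
  "D \<in> W \<longleftrightarrow>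
     (\<forall>p q. D (p + q) = D p + D q) \<and>
     (\<forall>c p. D (poly_scale c p) = poly_scale c (D p)) \<and>
     (\<forall>p q. D (p * q) = D p * q + p * D q)"
  by (simp add: W_def derivation_on_def)

lemma poly_scale_add: "poly_scale c (p + q) = poly_scale c p + poly_scale c q"
  and poly_scale_diff: "poly_scale c (p - q) = poly_scale c p - poly_scale c q"
  and poly_scale_mult_left: "poly_scale c (p * q) = poly_scale c p * q"
  and poly_scale_mult_right: "poly_scale c (p * q) = p * poly_scale c q"
  and poly_scale_commute: "poly_scale c (poly_scale b p) = poly_scale b (poly_scale c p)"
  by (simp_all add: poly_scale_conv_mult algebra_simps)

lemma W_diff:
  assumes "D \<in> W"
  shows "D (p - q) = D p - D q"
proof -
  have "D (p - q) + D q = D ((p - q) + q)"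
    using assms unfolding W_iff by metis
  then show ?thesis by (simp add: eq_diff_eq)
qed

lemma W_add_closed: "D \<in> W \<Longrightarrow> E \<in> W \<Longrightarrow> D + E \<in> W"
  by (auto simp: W_iff poly_scale_add algebra_simps)

lemma W_scale_closed:
  assumes "D \<in> W"
  shows "W_scale c D \<in> W"
  unfolding W_iff
proof (intro conjI allI)
  fix p q
  show "W_scale c D (p * q) = W_scale c D p * q + p * W_scale c D q"
    using assms
    by (simp add: W_iff W_scale_def poly_scale_add
          poly_scale_mult_left[symmetric] poly_scale_mult_right[symmetric])
qed (use assms in \<open>simp_all add: W_iff W_scale_def poly_scale_add poly_scale_commute\<close>)

lemma W_bracket_closed:
  assumes "D \<in> W" "E \<in> W"
  shows "W_bracket D E \<in> W"
  using assms by (auto simp: W_iff W_bracket_def poly_scale_diff algebra_simps)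

lemma W_bracket_self: "W_bracket D D = 0"
  by (simp add: W_bracket_def)

lemma W_jacobi:
  assumes "D \<in> W" "E \<in> W" "G \<in> W"
  shows "W_bracket D (W_bracket E G) + W_bracket E (W_bracket G D) + W_bracket G (W_bracket D E) = 0"
  by (rule ext) (simp add: W_bracket_def W_diff[OF assms(1)] W_diff[OF assms(2)] W_diff[OF assms(3)])

end

theory Submission
  imports Defs
begin

text \<open>
  Let \<open>H = \<Sum>\<^sub>k (k + 1) x\<^sub>k \<partial>\<^sub>k\<close>, and let the weight of \<open>x\<^sup>m\<close> be its eigenvalue
  \<open>\<Sum>\<^sub>i (i + 1) m\<^sub>i\<close> under \<open>H\<close>. Solving for coefficients, subtract an inner derivation so that
  \<open>d H\<close> commutes with \<open>H\<close>; applying \<open>d\<close> to \<open>[H, \<partial>\<^sub>i] = -(i + 1) \<partial>\<^sub>i\<close> then gives \<open>d H = 0\<close>.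
  Now the \<open>\<partial>\<^sub>k\<close>-component \<open>g\<^sub>i\<^sub>k\<close> of \<open>d \<partial>\<^sub>i\<close> has weight \<open>k - i\<close>, so it vanishes for \<open>i > k\<close>. This is
  what makes \<open>a\<^sub>k = (k + 1)\<^sup>-\<^sup>1 \<Sum>\<^bsub>i \<le> k\<^esub> (i + 1) x\<^sub>i g\<^sub>i\<^sub>k\<close> a polynomial, and \<open>\<Sum>\<^sub>k a\<^sub>k \<partial>\<^sub>k\<close> is a common
  potential for all the \<open>d \<partial>\<^sub>i\<close>; the Euler field alone would not give this finiteness.

  After a second subtraction \<open>d\<close> kills \<open>H\<close> and all \<open>\<partial>\<^sub>i\<close>, hence all diagonal fields. Let \<open>E\<close> be the
  Euler field. Any \<open>x\<close> is \<open>c + [E, y] + y\<close> with \<open>c\<close> constant; \<open>d ([E, y] + y) = [E, d y] + d y\<close> vanishes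
  at the origin, and so does \<open>d c\<close>, by bracketing with \<open>x\<^sub>k \<partial>\<^sub>k\<close>. Since \<open>d\<close> commutes with all \<open>[\<partial>\<^sub>i, \<cdot>]\<close>,
  all Taylor coefficients of \<open>d x\<close> vanish. No continuity of \<open>d\<close> with respect to infinite sums is used.
\<close>

section \<open>Vector fields in infinitely many variables\<close>

declare One_nat_def [simp del]

abbreviation lookup :: "('a \<Rightarrow>\<^sub>0 'b::zero) \<Rightarrow> 'a \<Rightarrow> 'b" where
  "lookup \<equiv> Poly_Mapping.lookup"

abbreviation keys :: "('a \<Rightarrow>\<^sub>0 'b::zero) \<Rightarrow> 'a set" where
  "keys \<equiv> Poly_Mapping.keys"

lemma lookup_poly_scale [simp]: "lookup (poly_scale c p) m = c * lookup p m"
  by (simp add: poly_scale_def map.rep_eq when_def)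

lemma poly_scale_single: "poly_scale c (Poly_Mapping.single m b) = Poly_Mapping.single m (c * b)"
  by (simp add: poly_scale_conv_mult mult_single)

lemma poly_scale_zero_left [simp]: "poly_scale 0 p = 0"
  and poly_scale_zero_right [simp]: "poly_scale c 0 = 0"
  and poly_scale_one [simp]: "poly_scale 1 p = p"
  and poly_scale_add_left: "poly_scale (c + b) p = poly_scale c p + poly_scale b p"
  and poly_scale_scale: "poly_scale c (poly_scale b p) = poly_scale (c * b) p"
  by (simp_all add: poly_scale_conv_mult single_add algebra_simps mult_single flip: mult.assoc)

lemma poly_scale_sum: "poly_scale c (sum g A) = (\<Sum>i\<in>A. poly_scale c (g i))"
  by (simp add: poly_scale_conv_mult sum_distrib_left)

lemma minus_single_add_single:
  fixes m :: "'a \<Rightarrow>\<^sub>0 nat"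
  assumes "i \<in> keys m"
  shows "(m - Poly_Mapping.single i 1) + Poly_Mapping.single i 1 = m"
  by (rule poly_mapping_eqI)
    (use assms in \<open>auto simp: lookup_add lookup_minus lookup_single when_def in_keys_iff\<close>)

text \<open>Serves twice: for polynomials, term by term, and for exponent vectors, variable by
  variable.\<close>

lemma poly_mapping_single_add_induct [case_names zero add]:
  fixes p :: "'a \<Rightarrow>\<^sub>0 'b::comm_monoid_add"
  assumes "P 0" and "\<And>m c q. P q \<Longrightarrow> P (Poly_Mapping.single m c + q)"
  shows "P p"
proof (induction p rule: update_induct)
  case (update q m c)
  have "Poly_Mapping.update m c q = Poly_Mapping.single m c + q"
    by (rule poly_mapping_eqI)
      (use update.hyps in \<open>auto simp: update.rep_eq lookup_add lookup_single when_def in_keys_iff\<close>)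
  then show ?case using assms(2) update.IH by simp
qed (rule assms(1))

abbreviation poly_var :: "nat \<Rightarrow> 'k::field polys" where
  "poly_var i \<equiv> Poly_Mapping.single (Poly_Mapping.single i 1) 1"

section \<open>Derivations of the polynomial algebra and their values on the variables\<close>

lemma W_add: "D \<in> W \<Longrightarrow> D (p + q) = D p + D q"
  and W_scale: "D \<in> W \<Longrightarrow> D (poly_scale c p) = poly_scale c (D p)"
  and W_mult: "D \<in> W \<Longrightarrow> D (p * q) = D p * q + p * D q"
  by (simp_all add: W_iff)

lemma W_zero [simp]: "D \<in> W \<Longrightarrow> D 0 = 0"
  using W_scale[of D 0 0] by simp

lemma W_sum: "D \<in> W \<Longrightarrow> D (sum g A) = (\<Sum>i\<in>A. D (g i))"
  by (induction A rule: infinite_finite_induct) (simp_all add: W_add)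

lemma W_one [simp]:
  assumes "D \<in> W"
  shows "D 1 = 0"
proof -
  have "D 1 = D 1 + D 1"
    using W_mult[OF assms, of 1 1] by (simp only: mult_1_left mult_1_right)
  then show ?thesis by (rule add_cancel_right_right[THEN iffD1])
qed

lemma W_const [simp]: "D \<in> W \<Longrightarrow> D (Poly_Mapping.single 0 c) = 0"
  using W_scale[of D c 1] by (simp add: poly_scale_conv_mult)

text \<open>The Leibniz rule carries agreement from variables to monomials one factor at a time, and
  linearity carries it to polynomials. Each polynomial involves finitely many variables, so no
  infinite sum enters.\<close>

lemma W_eqI:
  assumes D: "D \<in> W" and E: "E \<in> W" and eq: "\<And>i. D (poly_var i) = E (poly_var i)"
  shows "D = E"
proof
  fix p
  have mono: "D (Poly_Mapping.single m 1) = E (Poly_Mapping.single m 1)" for m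
  proof (induction m rule: poly_mapping_single_add_induct)
    case zero
    then show ?case using D E by simp
  next
    case (add i n m)
    show ?case
    proof (induction n)
      case 0
      then show ?case using add by simp
    next
      case (Suc n)
      have "Poly_Mapping.single (Poly_Mapping.single i (Suc n) + m) (1::'a)
        = poly_var i * Poly_Mapping.single (Poly_Mapping.single i n + m) 1"
        by (simp add: mult_single Suc_eq_plus1_left single_add add.assoc)
      then show ?case
        using Suc eq by (simp add: W_mult[OF D] W_mult[OF E])
    qed
  qed
  show "D p = E p"
  proof (induction p rule: poly_mapping_single_add_induct)
    case zero
    then show ?case using D E by simp
  next
    case (add m c q)
    then show ?case
      using W_scale[OF D, of c "Poly_Mapping.single m 1"] W_scale[OF E, of c "Poly_Mapping.single m 1"] mono
      by (simp add: W_add[OF D] W_add[OF E] poly_scale_single)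
  qed
qed

text \<open>\<open>vector_field f\<close> is \<open>\<Sum>\<^sub>i f\<^sub>i \<partial>/\<partial>x\<^sub>i\<close>.\<close>

definition monomial_deriv :: "(nat \<Rightarrow> 'k::field polys) \<Rightarrow> (nat \<Rightarrow>\<^sub>0 nat) \<Rightarrow> 'k polys" where
  "monomial_deriv f m =
     (\<Sum>i\<in>keys m. f i * Poly_Mapping.single (m - Poly_Mapping.single i 1) (of_nat (lookup m i)))"

definition vector_field :: "(nat \<Rightarrow> 'k::field polys) \<Rightarrow> 'k polys \<Rightarrow> 'k polys" where
  "vector_field f p = (\<Sum>m\<in>keys p. poly_scale (lookup p m) (monomial_deriv f m))"

text \<open>Outside \<open>keys m\<close> the factor \<open>of_nat (lookup m i)\<close> is zero.
  This lets two monomials be differentiated over one common index set.\<close>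

lemma monomial_deriv_superset:
  assumes "finite A" "keys m \<subseteq> A"
  shows "monomial_deriv f m =
     (\<Sum>i\<in>A. f i * Poly_Mapping.single (m - Poly_Mapping.single i 1) (of_nat (lookup m i)))"
  unfolding monomial_deriv_def
  by (rule sum.mono_neutral_left) (use assms in \<open>auto simp: in_keys_iff\<close>)

lemma monomial_deriv_add:
  "monomial_deriv f (m + n) =
     monomial_deriv f m * Poly_Mapping.single n 1 + Poly_Mapping.single m 1 * monomial_deriv f n"
proof -
  \<comment> \<open>Subtraction of exponents is truncated, so the shift needs \<open>x_i\<close> to
    occur in \<open>a\<close>. Where it does not occur, the coefficient is zero; hence the case
    splits below.\<close>
  have shift: "a - Poly_Mapping.single i 1 + b = a + b - Poly_Mapping.single i 1"
    if "lookup a i \<noteq> 0" for a b :: "nat \<Rightarrow>\<^sub>0 nat" and i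
    by (rule poly_mapping_eqI)
      (use that in \<open>auto simp: lookup_add lookup_minus lookup_single when_def\<close>)
  have shift': "b + (a - Poly_Mapping.single i 1) = b + a - Poly_Mapping.single i 1"
    if "lookup a i \<noteq> 0" for a b :: "nat \<Rightarrow>\<^sub>0 nat" and i
    using shift[OF that, of b] by (simp add: add.commute)
  let ?A = "keys m \<union> keys n"
  let ?t = "\<lambda>m i. f i * Poly_Mapping.single (m - Poly_Mapping.single i 1) (of_nat (lookup m i))"
  have "?t (m + n) i = ?t m i * Poly_Mapping.single n 1 + Poly_Mapping.single m 1 * ?t n i" for i
  proof -
    have 1: "Poly_Mapping.single (m - Poly_Mapping.single i 1) (of_nat (lookup m i)) * Poly_Mapping.single n 1
        = Poly_Mapping.single (m + n - Poly_Mapping.single i 1) (of_nat (lookup m i) :: 'a)"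
      by (cases "lookup m i = 0") (simp_all add: mult_single shift)
    have 2: "Poly_Mapping.single m 1 * Poly_Mapping.single (n - Poly_Mapping.single i 1) (of_nat (lookup n i))
        = Poly_Mapping.single (m + n - Poly_Mapping.single i 1) (of_nat (lookup n i) :: 'a)"
      by (cases "lookup n i = 0") (simp_all add: mult_single shift')
    have "?t (m + n) i =
      f i * (Poly_Mapping.single (m + n - Poly_Mapping.single i 1) (of_nat (lookup m i))
        + Poly_Mapping.single (m + n - Poly_Mapping.single i 1) (of_nat (lookup n i)))"
      by (simp add: lookup_add single_add)
    then show ?thesis
      by (simp only: 1[symmetric] 2[symmetric]) (simp only: algebra_simps)
  qed
  moreover have "monomial_deriv f (m + n) = sum (?t (m + n)) ?A"
    using keys_add[of m n] by (intro monomial_deriv_superset) auto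
  moreover have "monomial_deriv f m = sum (?t m) ?A" "monomial_deriv f n = sum (?t n) ?A"
    by (intro monomial_deriv_superset; auto)+
  ultimately show ?thesis
    by (simp only: sum.distrib sum_distrib_left sum_distrib_right)
qed

lemma vector_field_add: "vector_field f (p + q) = vector_field f p + vector_field f q"
  unfolding vector_field_def
  by (rule setsum_keys_plus_distrib) (simp_all add: poly_scale_add_left)

lemma vector_field_single:
  "vector_field f (Poly_Mapping.single m c) = poly_scale c (monomial_deriv f m)"
  by (simp add: vector_field_def)

lemma vector_field_zero [simp]: "vector_field f 0 = 0"
  by (simp add: vector_field_def)

text \<open>The Leibniz rule holds for pairs of monomials by \<open>monomial_deriv_add\<close> and
  spreads additively, first in the right factor, then in the left.\<close>

lemma vector_field_in_W [simp]: "vector_field f \<in> W"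
  unfolding W_iff
proof (intro conjI allI)
  fix p q :: "'a polys" and c :: 'a
  show "vector_field f (p + q) = vector_field f p + vector_field f q"
    by (rule vector_field_add)
  show "vector_field f (poly_scale c p) = poly_scale c (vector_field f p)"
    by (induction p rule: poly_mapping_single_add_induct)
      (simp_all add: poly_scale_add vector_field_add poly_scale_single vector_field_single poly_scale_scale)
  have single: "vector_field f (Poly_Mapping.single m b * Poly_Mapping.single n c) =
     vector_field f (Poly_Mapping.single m b) * Poly_Mapping.single n c +
     Poly_Mapping.single m b * vector_field f (Poly_Mapping.single n c)" for m n b c
  proof -
    have s: "Poly_Mapping.single k a = poly_scale a (Poly_Mapping.single k 1)" for k and a :: 'a
      by (simp add: poly_scale_single)
    show ?thesis
      by (subst (2) s[of n c], subst (2) s[of m b])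
        (simp add: mult_single vector_field_single monomial_deriv_add poly_scale_add poly_scale_scale
          poly_scale_mult_left[symmetric] poly_scale_mult_right[symmetric] mult.commute)
  qed
  have left: "vector_field f (Poly_Mapping.single m b * q) =
     vector_field f (Poly_Mapping.single m b) * q + Poly_Mapping.single m b * vector_field f q" for m b q
    by (induction q rule: poly_mapping_single_add_induct)
      (simp_all add: vector_field_add single distrib_left algebra_simps)
  show "vector_field f (p * q) = vector_field f p * q + p * vector_field f q"
    by (induction p rule: poly_mapping_single_add_induct)
      (simp_all add: vector_field_add left distrib_right add.assoc add.left_commute)
qed

lemma vector_field_var [simp]: "vector_field f (poly_var i) = f i"
  by (simp add: vector_field_single monomial_deriv_def)

section \<open>Partial derivatives and diagonal fields\<close>

definition partial :: "nat \<Rightarrow> 'k::field polys \<Rightarrow> 'k polys" where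
  "partial i = vector_field (\<lambda>j. Poly_Mapping.single 0 (1 when j = i))"

text \<open>Three choices of \<open>\<mu>\<close> matter later: constant \<open>1\<close> gives
  \<open>E\<close>, \<open>k + 1\<close> gives \<open>H\<close>, and an indicator gives a single
  \<open>x_k \<partial>_k\<close>.\<close>

definition weighted_Euler :: "(nat \<Rightarrow> 'k::field) \<Rightarrow> 'k polys \<Rightarrow> 'k polys" where
  "weighted_Euler \<mu> = vector_field (\<lambda>j. poly_scale (\<mu> j) (poly_var j))"

definition weight :: "(nat \<Rightarrow> 'k::semiring_1) \<Rightarrow> (nat \<Rightarrow>\<^sub>0 nat) \<Rightarrow> 'k" where
  "weight \<mu> m = (\<Sum>i\<in>keys m. \<mu> i * of_nat (lookup m i))"

lemma partial_in_W [simp]: "partial i \<in> W"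
  and weighted_Euler_in_W [simp]: "weighted_Euler \<mu> \<in> W"
  by (simp_all add: partial_def weighted_Euler_def)

lemma partial_var: "partial i (poly_var j) = Poly_Mapping.single 0 (1 when j = i)"
  and weighted_Euler_var: "weighted_Euler \<mu> (poly_var j) = poly_scale (\<mu> j) (poly_var j)"
  by (simp_all add: partial_def weighted_Euler_def)

text \<open>Indexing by the shifted monomial makes the factor a successor, nonzero in characteristic
  zero. So every coefficient except the constant one can be recovered from some partial
  derivative.\<close>

lemma lookup_partial:
  "lookup (partial i p) m = of_nat (Suc (lookup m i)) * lookup p (m + Poly_Mapping.single i 1)"
proof (induction p rule: poly_mapping_single_add_induct)
  case zero
  then show ?case by simp
next
  case (add n c q)
  have eq: "monomial_deriv (\<lambda>j. Poly_Mapping.single 0 (1 when j = i)) n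
      = Poly_Mapping.single (n - Poly_Mapping.single i 1) (of_nat (lookup n i) :: 'a)"
  proof -
    have "monomial_deriv (\<lambda>j. Poly_Mapping.single 0 (1 when j = i)) n
      = (\<Sum>j\<in>insert i (keys n). Poly_Mapping.single 0 (1 when j = i)
          * Poly_Mapping.single (n - Poly_Mapping.single j 1) (of_nat (lookup n j) :: 'a))"
      by (intro monomial_deriv_superset) auto
    also have "\<dots> = (\<Sum>j\<in>{i}. Poly_Mapping.single 0 (1 when j = i)
          * Poly_Mapping.single (n - Poly_Mapping.single j 1) (of_nat (lookup n j) :: 'a))"
      by (rule sum.mono_neutral_right) auto
    finally show ?thesis by simp
  qed
  have "n - Poly_Mapping.single i 1 = m \<longleftrightarrow> n = m + Poly_Mapping.single i 1"
    if "lookup n i \<noteq> 0"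
    using minus_single_add_single[of i n] that by (auto simp: in_keys_iff)
  then have "lookup (partial i (Poly_Mapping.single n c)) m
      = of_nat (Suc (lookup m i)) * lookup (Poly_Mapping.single n c) (m + Poly_Mapping.single i 1)"
    by (cases "lookup n i = 0")
      (auto simp: partial_def vector_field_single eq poly_scale_single lookup_single lookup_minus lookup_add
        simp del: of_nat_Suc)
  then show ?case
    using add by (simp add: W_add[OF partial_in_W] lookup_add algebra_simps)
qed

lemma lookup_weighted_Euler: "lookup (weighted_Euler \<mu> p) m = weight \<mu> m * lookup p m"
proof (induction p rule: poly_mapping_single_add_induct)
  case zero
  then show ?case by simp
next
  case (add n c q)
  have "monomial_deriv (\<lambda>j. poly_scale (\<mu> j) (poly_var j)) n = Poly_Mapping.single n (weight \<mu> n)"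
  proof -
    have "poly_scale (\<mu> j) (poly_var j) * Poly_Mapping.single (n - Poly_Mapping.single j 1) (of_nat (lookup n j))
        = Poly_Mapping.single n (\<mu> j * of_nat (lookup n j))" if "j \<in> keys n" for j
      using minus_single_add_single[OF that]
      by (simp add: poly_scale_single mult_single add.commute)
    moreover have "sum (\<lambda>j. Poly_Mapping.single n (g j)) A = Poly_Mapping.single n (sum g A)"
      for g :: "nat \<Rightarrow> 'a" and A
      by (induction A rule: infinite_finite_induct) (simp_all add: single_add)
    ultimately show ?thesis by (simp add: monomial_deriv_def weight_def)
  qed
  then have "lookup (weighted_Euler \<mu> (Poly_Mapping.single n c)) m
      = weight \<mu> m * lookup (Poly_Mapping.single n c) m"
    by (simp add: weighted_Euler_def vector_field_single poly_scale_single lookup_single when_def)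
  then show ?case
    using add by (simp add: W_add[OF weighted_Euler_in_W] lookup_add algebra_simps)
qed

section \<open>Coefficients and weights\<close>

lemma weight_zero [simp]: "weight \<mu> 0 = 0"
  by (simp add: weight_def)

lemma weight_superset:
  assumes "finite A" "keys m \<subseteq> A"
  shows "weight \<mu> m = (\<Sum>i\<in>A. \<mu> i * of_nat (lookup m i))"
  unfolding weight_def
  by (rule sum.mono_neutral_left) (use assms in \<open>auto simp: in_keys_iff\<close>)

lemma weight_single [simp]: "weight \<mu> (Poly_Mapping.single i n) = \<mu> i * of_nat n"
  by (simp add: weight_def)

lemma weight_add: "weight \<mu> (m + n) = weight \<mu> m + weight \<mu> n"
  unfolding weight_def by (rule setsum_keys_plus_distrib) (simp_all add: distrib_left)

lemma weight_of_nat: "weight (\<lambda>i. of_nat (f i)) m = of_nat (weight f m)"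
  by (simp add: weight_def)

lemma weight_indicator: "weight (\<lambda>j. 1 when j = i) m = of_nat (lookup m i)"
proof -
  have "weight (\<lambda>j. 1 when j = i) m = (\<Sum>j\<in>insert i (keys m). (1 when j = i) * of_nat (lookup m j))"
    by (rule weight_superset) auto
  also have "\<dots> = (\<Sum>j\<in>{i}. (1 when j = i) * of_nat (lookup m j))"
    by (rule sum.mono_neutral_right) auto
  finally show ?thesis by simp
qed

abbreviation field_coeff :: "('k::field polys \<Rightarrow> 'k polys) \<Rightarrow> nat \<Rightarrow> (nat \<Rightarrow>\<^sub>0 nat) \<Rightarrow> 'k" where
  "field_coeff x k m \<equiv> lookup (x (poly_var k)) m"

lemma W_coeff_eqI:
  assumes "x \<in> W" "y \<in> W" "\<And>k m. field_coeff x k m = field_coeff y k m"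
  shows "x = y"
  by (rule W_eqI) (use assms in \<open>auto intro: poly_mapping_eqI\<close>)

lemma W_zero_closed [simp]: "0 \<in> W"
  by (simp add: W_iff)

text \<open>Every \<open>x^m \<partial>_k\<close> is an eigenvector: \<open>weight \<mu> m\<close>
  comes from differentiating the component, \<open>\<mu> k\<close> from applying \<open>x\<close> to
  \<open>\<mu>_k x_k\<close>.\<close>

lemma field_coeff_bracket_Euler:
  assumes "x \<in> W"
  shows "field_coeff (W_bracket (weighted_Euler \<mu>) x) k m = (weight \<mu> m - \<mu> k) * field_coeff x k m"
  by (simp add: W_bracket_def lookup_minus lookup_weighted_Euler weighted_Euler_var W_scale[OF assms]
      left_diff_distrib)

text \<open>\<open>partial i\<close> sends a variable to a constant, which \<open>x\<close> kills;
  only one term of the commutator survives.\<close>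

lemma bracket_partial_var:
  assumes "x \<in> W"
  shows "W_bracket (partial i) x (poly_var k) = partial i (x (poly_var k))"
  by (simp add: W_bracket_def partial_var assms)

lemma field_coeff_bracket_partial:
  assumes "x \<in> W"
  shows "field_coeff (W_bracket (partial i) x) k m =
    of_nat (Suc (lookup m i)) * field_coeff x k (m + Poly_Mapping.single i 1)"
  by (simp only: bracket_partial_var[OF assms] lookup_partial)

lemma field_coeff_partial: "field_coeff (partial i) k m = (1 when k = i \<and> m = 0)"
  by (simp add: partial_var lookup_single when_def)

lemma field_coeff_weighted_Euler:
  "field_coeff (weighted_Euler \<mu>) k m = (\<mu> k when m = Poly_Mapping.single k 1)"
  by (auto simp: weighted_Euler_var lookup_single when_def)

lemma bracket_Euler_partial:
  "W_bracket (weighted_Euler \<mu>) (partial i) = W_scale (- \<mu> i) (partial i)"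
proof (rule W_coeff_eqI)
  show "field_coeff (W_bracket (weighted_Euler \<mu>) (partial i)) k m = field_coeff (W_scale (- \<mu> i) (partial i)) k m" for k m
    by (auto simp: field_coeff_bracket_Euler W_scale_def field_coeff_partial when_def)
qed (simp_all add: W_bracket_closed W_scale_closed)

lemma bracket_Euler_Euler: "W_bracket (weighted_Euler \<mu>) (weighted_Euler \<nu>) = 0"
  by (rule W_coeff_eqI)
    (auto simp: W_bracket_closed field_coeff_bracket_Euler field_coeff_weighted_Euler when_def)

lemma add_single_ne_zero: "m + Poly_Mapping.single i 1 \<noteq> (0 :: 'a \<Rightarrow>\<^sub>0 nat)"
proof
  assume "m + Poly_Mapping.single i 1 = 0"
  then have "lookup (m + Poly_Mapping.single i 1) i = 0" by simp
  then show False by (simp add: lookup_add)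
qed

lemma bracket_partial_partial: "W_bracket (partial i) (partial j) = 0"
  by (rule W_coeff_eqI)
    (auto simp: W_bracket_closed field_coeff_bracket_partial field_coeff_partial add_single_ne_zero)

lemma W_bracket_zero [simp]:
  assumes "x \<in> W"
  shows "W_bracket 0 x = 0" "W_bracket x 0 = 0"
  using assms by (auto simp: W_bracket_def fun_eq_iff)

lemma W_bracket_minus: "W_bracket x y = - W_bracket y x"
  by (simp add: W_bracket_def)

text \<open>Used to invert bracket operators that are diagonal in the
  \<open>x^m \<partial>_k\<close>, and to cut out constant parts. \<open>mapp\<close> touches only
  the keys, so components stay polynomials for arbitrary \<open>\<phi>\<close>.\<close>

definition rescale ::
    "(nat \<Rightarrow> (nat \<Rightarrow>\<^sub>0 nat) \<Rightarrow> 'k) \<Rightarrow> ('k::field polys \<Rightarrow> 'k polys) \<Rightarrow> 'k polys \<Rightarrow> 'k polys" where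
  "rescale \<phi> x = vector_field (\<lambda>k. Poly_Mapping.mapp (\<lambda>m c. \<phi> k m * c) (x (poly_var k)))"

lemma rescale_in_W [simp]: "rescale \<phi> x \<in> W"
  by (simp add: rescale_def)

lemma field_coeff_rescale: "field_coeff (rescale \<phi> x) k m = \<phi> k m * field_coeff x k m"
  by (auto simp: rescale_def lookup_mapp when_def in_keys_iff)

section \<open>Derivations of the Lie algebra of vector fields\<close>

abbreviation (input) lie_derivation ::
    "(('k::field polys \<Rightarrow> 'k polys) \<Rightarrow> ('k polys \<Rightarrow> 'k polys)) \<Rightarrow> bool" where
  "lie_derivation d \<equiv> derivation_on W_scale W_bracket W d"

lemma lie_derivation_closed: "lie_derivation d \<Longrightarrow> x \<in> W \<Longrightarrow> d x \<in> W"
  and lie_derivation_add: "lie_derivation d \<Longrightarrow> x \<in> W \<Longrightarrow> y \<in> W \<Longrightarrow> d (x + y) = d x + d y"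
  and lie_derivation_scale: "lie_derivation d \<Longrightarrow> x \<in> W \<Longrightarrow> d (W_scale c x) = W_scale c (d x)"
  and lie_derivation_bracket:
    "lie_derivation d \<Longrightarrow> x \<in> W \<Longrightarrow> y \<in> W \<Longrightarrow>
      d (W_bracket x y) = W_bracket (d x) y + W_bracket x (d y)"
  by (simp_all add: derivation_on_def)

lemma lie_derivation_zero: "lie_derivation d \<Longrightarrow> d 0 = 0"
  using lie_derivation_add[of d 0 0] by simp

lemma W_diff_closed: "x \<in> W \<Longrightarrow> y \<in> W \<Longrightarrow> x - y \<in> W"
  by (auto simp: W_iff poly_scale_diff algebra_simps)

lemma lie_derivation_minus_inner:
  assumes d: "lie_derivation d" and a: "a \<in> W"
  shows "lie_derivation (\<lambda>x. d x - W_bracket x a)"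
  unfolding derivation_on_def
proof (intro conjI ballI allI)
  fix x y :: "'a polys \<Rightarrow> 'a polys" and c
  assume x: "x \<in> W"
  note [simp] = W_diff[OF x] W_diff[OF a] W_add[OF x] W_add[OF a] W_scale[OF x] W_scale[OF a]
  show "d x - W_bracket x a \<in> W"
    by (intro W_diff_closed W_bracket_closed lie_derivation_closed[OF d] x a)
  show "d (W_scale c x) - W_bracket (W_scale c x) a = W_scale c (d x - W_bracket x a)"
    by (rule ext) (simp add: lie_derivation_scale[OF d x], simp add: W_bracket_def W_scale_def poly_scale_diff)
  assume y: "y \<in> W"
  note [simp] = W_diff[OF y] W_add[OF y] W_scale[OF y]
  show "d (x + y) - W_bracket (x + y) a = d x - W_bracket x a + (d y - W_bracket y a)"
    by (rule ext) (simp add: lie_derivation_add[OF d x y], simp add: W_bracket_def)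
  \<comment> \<open>The contribution of \<open>a\<close> is the Jacobi identity, checked by
    expanding the commutators.\<close>
  show "d (W_bracket x y) - W_bracket (W_bracket x y) a =
    W_bracket (d x - W_bracket x a) y + W_bracket x (d y - W_bracket y a)"
    by (rule ext) (simp add: lie_derivation_bracket[OF d x y], simp add: W_bracket_def)
qed

section \<open>First correction: making \<open>d\<close> vanish on \<open>H\<close>\<close>

definition height_field :: "'k::field polys \<Rightarrow> 'k polys" where
  "height_field = weighted_Euler (\<lambda>k. of_nat (Suc k))"

lemma height_field_in_W [simp]: "height_field \<in> W"
  by (simp add: height_field_def)

text \<open>The weight is computed in \<open>nat\<close> and then cast, so in characteristic zero
  equal eigenvalues give equations between natural numbers.\<close>

lemma field_coeff_bracket_height:
  assumes "x \<in> W"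
  shows "field_coeff (W_bracket height_field x) k m =
    (of_nat (weight Suc m) - of_nat (Suc k)) * field_coeff x k m"
  by (simp only: height_field_def field_coeff_bracket_Euler[OF assms] weight_of_nat)

text \<open>
  Apply \<open>d\<close> to \<open>[H, \<partial>\<^sub>i] = -(i + 1) \<partial>\<^sub>i\<close>: where \<open>d H\<close> commutes with \<open>H\<close>, the terms involving
  \<open>d \<partial>\<^sub>i\<close> cancel.
\<close>

lemma derivation_height_partial:
  assumes d: "lie_derivation d"
  shows "of_nat (Suc (lookup m i)) * field_coeff (d height_field) k (m + Poly_Mapping.single i 1) =
    (of_nat (weight Suc m) + of_nat (Suc i) - of_nat (Suc k)) * field_coeff (d (partial i)) k m"
proof -
  note dW = lie_derivation_closed[OF d]
  have "W_bracket (d height_field) (partial i) + W_bracket height_field (d (partial i))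
      = W_scale (- of_nat (Suc i)) (d (partial i))"
    by (simp only: lie_derivation_bracket[OF d, symmetric] lie_derivation_scale[OF d, symmetric]
        height_field_in_W partial_in_W) (simp only: height_field_def bracket_Euler_partial)
  from arg_cong[OF this, of "\<lambda>x. field_coeff x k m"] have
    "- field_coeff (W_bracket (partial i) (d height_field)) k m
      + field_coeff (W_bracket height_field (d (partial i))) k m
      = field_coeff (W_scale (- of_nat (Suc i)) (d (partial i))) k m"
    by (simp only: W_bracket_minus[of "d height_field" "partial i"]
        uminus_apply lookup_uminus lookup_add plus_fun_apply)
  then show ?thesis
    by (simp add: field_coeff_bracket_partial field_coeff_bracket_height dW W_scale_def
        algebra_simps del: of_nat_Suc)
qed

lemma derivation_height_inner:
  fixes d :: "('k::field_char_0 polys \<Rightarrow> 'k polys) \<Rightarrow> ('k polys \<Rightarrow> 'k polys)"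
  assumes d: "lie_derivation d"
  shows "\<exists>a\<in>W. d height_field = W_bracket height_field a"
proof -
  \<comment> \<open>As \<open>inverse 0 = 0\<close>, \<open>[H, a]\<close> is \<open>d H\<close> without its component in the kernel of \<open>[H, \<cdot>]\<close>.\<close>
  define a where "a = rescale (\<lambda>k m. inverse (of_nat (weight Suc m) - of_nat (Suc k))) (d height_field)"
  define e where "e = (\<lambda>x. d x - W_bracket x a)"
  have aW: "a \<in> W" by (simp add: a_def)
  have e: "lie_derivation e"
    unfolding e_def by (rule lie_derivation_minus_inner[OF d aW])
  \<comment> \<open>Subtracting the bracket with \<open>a\<close> removes all coefficients of
    nonzero eigenvalue; what is left commutes with \<open>H\<close>.\<close>
  have weight0: "weight Suc m = Suc k" if "field_coeff (e height_field) k m \<noteq> 0" for k m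
  proof (rule ccontr)
    assume "weight Suc m \<noteq> Suc k"
    then have "of_nat (weight Suc m) - of_nat (Suc k) \<noteq> (0::'k)"
      by (simp only: right_minus_eq of_nat_eq_iff)  simp
    then have "field_coeff (W_bracket height_field a) k m = field_coeff (d height_field) k m"
      by (simp add: field_coeff_bracket_height[OF aW] del: of_nat_Suc)
        (simp add: a_def field_coeff_rescale del: of_nat_Suc)
    then show False using that by (simp add: e_def lookup_minus)
  qed
  have "e height_field = 0"
  proof (rule W_coeff_eqI)
    fix k m
    show "field_coeff (e height_field) k m = field_coeff 0 k m"
    proof (rule ccontr)
      assume "field_coeff (e height_field) k m \<noteq> field_coeff 0 k m"
      then have nz: "field_coeff (e height_field) k m \<noteq> 0" by simp
      have w: "weight Suc m = Suc k" by (rule weight0[OF nz])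
      \<comment> \<open>The weight \<open>Suc k\<close> is positive, so some \<open>x_i\<close>
        occurs in \<open>m\<close> and the coefficient is visible to
        \<open>\<partial>_i\<close>.\<close>
      then have "m \<noteq> 0" by auto
      then obtain i where i: "i \<in> keys m" using keys_eq_empty by blast
      define n where "n = m - Poly_Mapping.single i 1"
      have m: "m = n + Poly_Mapping.single i 1"
        unfolding n_def by (rule minus_single_add_single[OF i, symmetric])
      \<comment> \<open>This kills the right side of \<open>derivation_height_partial\<close>,
        whatever \<open>e (partial i)\<close> is.\<close>
      have "weight Suc n + Suc i = Suc k"
        using w by (simp add: m weight_add)
      then have "of_nat (weight Suc n) + of_nat (Suc i) - of_nat (Suc k) = (0::'k)"
        by (simp only: flip: of_nat_add) simp
      then show False
        using derivation_height_partial[OF e, of n i k] nz by (simp add: m del: of_nat_Suc)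
    qed
  qed (simp_all add: lie_derivation_closed[OF e])
  then show ?thesis using aW by (auto simp: e_def)
qed

section \<open>Second correction: a common potential for the values on the partial
  derivatives\<close>

lemma poly_mult_in_W: "x \<in> W \<Longrightarrow> (\<lambda>p. f * x p) \<in> W"
  by (simp add: W_iff poly_scale_mult_right algebra_simps)

text \<open>\<open>x_i \<partial>_i\<close> is the diagonal field with indicator weights, whose
  eigenvalue on a monomial is the exponent of \<open>x_i\<close>.\<close>

lemma lookup_var_partial: "lookup (poly_var i * partial i p) m = of_nat (lookup m i) * lookup p m"
proof -
  have "(\<lambda>p. poly_var i * partial i p) = weighted_Euler (\<lambda>j. 1 when j = i)"
  proof (rule W_eqI)
    fix j
    show "poly_var i * partial i (poly_var j) = weighted_Euler (\<lambda>j. 1 when j = i) (poly_var j)"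
      by (simp add: partial_var weighted_Euler_var) (simp add: when_def)
  qed (simp_all add: poly_mult_in_W)
  then have "poly_var i * partial i p = weighted_Euler (\<lambda>j. 1 when j = i) p"
    by (rule fun_cong)
  then show ?thesis
    by (simp only: lookup_weighted_Euler weight_indicator)
qed

text \<open>Weights grow with the index, so bounding the weight of a monomial bounds the variables
  in it.\<close>

lemma weight_Suc_ge:
  assumes "i \<in> keys m"
  shows "Suc i \<le> weight Suc m"
proof -
  have "Suc i * 1 \<le> Suc i * of_nat (lookup m i)"
    using assms by (intro mult_le_mono2) (simp add: in_keys_iff Suc_leI One_nat_def)
  also have "\<dots> \<le> weight Suc m"
    unfolding weight_def by (rule member_le_sum) (use assms in auto)
  finally show ?thesis by simp
qed

text \<open>A weighted Poincare lemma. The clause \<open>W_bracket height_field a = 0\<close> keeps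
  \<open>H\<close> in the kernel when the bracket with \<open>a\<close> is subtracted.\<close>

lemma derivation_partials_inner:
  fixes d :: "('k::field_char_0 polys \<Rightarrow> 'k polys) \<Rightarrow> ('k polys \<Rightarrow> 'k polys)"
  assumes d: "lie_derivation d" and H0: "d height_field = 0"
  shows "\<exists>a\<in>W. W_bracket height_field a = 0 \<and> (\<forall>i. d (partial i) = W_bracket (partial i) a)"
proof -
  define G where "G = (\<lambda>i. d (partial i))"
  have GW: "G i \<in> W" for i
    by (simp add: G_def lie_derivation_closed[OF d])
  have weight_G: "weight Suc m + Suc i = Suc k" if "field_coeff (G i) k m \<noteq> 0" for i k m
  proof -
    have "of_nat (weight Suc m) + of_nat (Suc i) - of_nat (Suc k) = (0::'k)"
      using derivation_height_partial[OF d, of m i k] that by (simp add: H0 G_def del: of_nat_Suc)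
    then have "of_nat (weight Suc m + Suc i) = (of_nat (Suc k) :: 'k)"
      by (simp only: of_nat_add right_minus_eq)
    then show ?thesis by (simp only: of_nat_eq_iff)
  qed
  \<comment> \<open>Closedness comes from applying \<open>d\<close> to
    \<open>[\<partial>_i, \<partial>_j] = 0\<close>.\<close>
  have closed: "partial i (G j (poly_var k)) = partial j (G i (poly_var k))" for i j k
  proof -
    have "W_bracket (G i) (partial j) + W_bracket (partial i) (G j) = 0"
      by (simp add: G_def lie_derivation_bracket[OF d, symmetric] bracket_partial_partial
          lie_derivation_zero[OF d])
    then have "W_bracket (partial i) (G j) = W_bracket (partial j) (G i)"
      by (simp only: W_bracket_minus[of "G i" "partial j"]) simp
    from fun_cong[OF this, of "poly_var k"] show ?thesis
      by (simp only: bracket_partial_var GW)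
  qed
  \<comment> \<open>The homotopy formula: contract the closed family with \<open>H\<close> and
    divide by \<open>Suc k\<close>, the total weight of \<open>x_i g_ik\<close>. By
    \<open>weight_G\<close> the terms with \<open>i > k\<close> vanish, so the sum may stop at
    \<open>k\<close>.\<close>
  define a where "a = vector_field (\<lambda>k. \<Sum>i\<le>k.
    poly_scale (of_nat (Suc i) / of_nat (Suc k)) (poly_var i * G i (poly_var k)))"
  have aW: "a \<in> W" by (simp add: a_def)
  have a_var: "a (poly_var k) =
    (\<Sum>i\<le>k. poly_scale (of_nat (Suc i) / of_nat (Suc k)) (poly_var i * G i (poly_var k)))" for k
    by (simp only: a_def vector_field_var)
  have "G j = W_bracket (partial j) a" for j
  proof (rule W_coeff_eqI)
    fix k m
    let ?g = "field_coeff (G j) k m"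
    \<comment> \<open>Closedness replaces \<open>\<partial>_j g_ik\<close> by
      \<open>\<partial>_i g_jk\<close>, so every \<open>x_i \<partial>_i\<close> acts on the same
      polynomial.\<close>
    have "field_coeff (W_bracket (partial j) a) k m = (\<Sum>i\<le>k. of_nat (Suc i) / of_nat (Suc k) *
        lookup (Poly_Mapping.single 0 (1 when i = j) * G i (poly_var k)
          + poly_var i * partial i (G j (poly_var k))) m)"
      by (simp only: bracket_partial_var[OF aW] a_var W_sum[OF partial_in_W] W_scale[OF partial_in_W]
          W_mult[OF partial_in_W] partial_var lookup_sum lookup_poly_scale closed[of j])
    also have "\<dots> = (\<Sum>i\<le>k. of_nat (Suc i) / of_nat (Suc k) *
        ((1 when i = j) * field_coeff (G i) k m + of_nat (lookup m i) * ?g))"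
      by (simp only: lookup_add lookup_var_partial poly_scale_conv_mult[symmetric] lookup_poly_scale)
    also have "\<dots> = ?g"
    proof (cases "?g = 0")
      case True
      then show ?thesis by (auto simp: when_def intro!: sum.neutral)
    next
      case False
      have w: "weight Suc m + Suc j = Suc k" by (rule weight_G[OF False])
      \<comment> \<open>By \<open>w\<close>, both \<open>j\<close> and all variables of
        \<open>m\<close> have index at most \<open>k\<close>; the cut-off loses neither.\<close>
      have "keys m \<subseteq> {..k}"
        using weight_Suc_ge[of _ m] w by fastforce
      then have "(\<Sum>i\<le>k. of_nat (Suc i) * of_nat (lookup m i)) = (of_nat (weight Suc m) :: 'k)"
        by (simp only: weight_superset[of "{..k}"] finite_atMost flip: of_nat_mult of_nat_sum)
          simp
      moreover have "(\<Sum>i\<le>k. of_nat (Suc i) * ((1 when i = j) * field_coeff (G i) k m))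
          = of_nat (Suc j) * ?g"
      proof -
        have "(\<Sum>i\<le>k. of_nat (Suc i) * ((1 when i = j) * field_coeff (G i) k m))
          = (\<Sum>i\<in>{j}. of_nat (Suc i) * ((1 when i = j) * field_coeff (G i) k m))"
          by (rule sum.mono_neutral_right) (use w in auto)
        then show ?thesis by simp
      qed
      ultimately have "(\<Sum>i\<le>k. of_nat (Suc i) *
          ((1 when i = j) * field_coeff (G i) k m + of_nat (lookup m i) * ?g))
        = (of_nat (Suc j) + of_nat (weight Suc m)) * ?g"
        by (simp only: distrib_left distrib_right sum.distrib mult.assoc[symmetric] sum_distrib_right[symmetric])
      also have "of_nat (Suc j) + of_nat (weight Suc m) = (of_nat (Suc k) :: 'k)"
        by (simp only: flip: w of_nat_add) (simp only: add.commute)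
      finally show ?thesis
        by (simp add: sum_divide_distrib[symmetric] del: of_nat_Suc)
    qed
    finally show "?g = field_coeff (W_bracket (partial j) a) k m" ..
  qed (simp_all add: GW aW W_bracket_closed)
  \<comment> \<open>Each \<open>x_i g_ik\<close> has weight
    \<open>(i + 1) + (k - i) = k + 1\<close>, the same as \<open>x_k\<close>.\<close>
  moreover have "W_bracket height_field a = 0"
  proof (rule W_eqI)
    fix k
    have H_G: "height_field (G i (poly_var k))
        = poly_scale (of_nat (Suc k) - of_nat (Suc i)) (G i (poly_var k))" for i
    proof (rule poly_mapping_eqI)
      fix m
      show "lookup (height_field (G i (poly_var k))) m
          = lookup (poly_scale (of_nat (Suc k) - of_nat (Suc i)) (G i (poly_var k))) m"
      proof (cases "field_coeff (G i) k m = 0")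
        case True
        then show ?thesis
          by (simp add: height_field_def lookup_weighted_Euler)
      next
        case False
        have "of_nat (weight Suc m) = (of_nat (Suc k) - of_nat (Suc i) :: 'k)"
          by (simp only: weight_G[OF False, symmetric] of_nat_add) simp
        then show ?thesis
          by (simp only: height_field_def lookup_weighted_Euler lookup_poly_scale weight_of_nat)
      qed
    qed
    have H_term: "height_field (poly_var i * G i (poly_var k))
        = poly_scale (of_nat (Suc k)) (poly_var i * G i (poly_var k))" for i
    proof -
      have "height_field (poly_var i * G i (poly_var k))
        = poly_scale (of_nat (Suc i)) (poly_var i * G i (poly_var k))
          + poly_scale (of_nat (Suc k) - of_nat (Suc i)) (poly_var i * G i (poly_var k))"
        by (simp only: W_mult[OF height_field_in_W] H_G poly_scale_mult_left poly_scale_mult_right[symmetric])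
          (simp only: height_field_def weighted_Euler_var poly_scale_mult_left)
      then show ?thesis
        by (simp only: poly_scale_add_left[symmetric]) simp
    qed
    have "height_field (a (poly_var k)) = poly_scale (of_nat (Suc k)) (a (poly_var k))"
      by (simp only: a_var W_sum[OF height_field_in_W] W_scale[OF height_field_in_W] H_term
          poly_scale_sum) (simp only: poly_scale_commute)
    moreover have "a (height_field (poly_var k)) = poly_scale (of_nat (Suc k)) (a (poly_var k))"
      by (simp only: height_field_def weighted_Euler_var W_scale[OF aW])
    ultimately show "W_bracket height_field a (poly_var k) = 0 (poly_var k)"
      by (simp add: W_bracket_def)
  qed (simp_all add: aW W_bracket_closed)
  ultimately show ?thesis
    using aW by (auto simp: G_def)
qed

section \<open>Derivations that kill \<open>H\<close> and all partial derivatives\<close>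

lemma derivation_weighted_Euler_zero:
  fixes d :: "('k::field_char_0 polys \<Rightarrow> 'k polys) \<Rightarrow> ('k polys \<Rightarrow> 'k polys)"
  assumes d: "lie_derivation d" and H0: "d height_field = 0" and p0: "\<And>i. d (partial i) = 0"
  shows "d (weighted_Euler \<mu>) = 0"
proof -
  let ?t = "d (weighted_Euler \<mu>)"
  have tW: "?t \<in> W" by (simp add: lie_derivation_closed[OF d])
  have "W_bracket ?t (partial i) = 0" for i
    using lie_derivation_bracket[OF d weighted_Euler_in_W partial_in_W, of \<mu> i]
      lie_derivation_scale[OF d partial_in_W, of "- \<mu> i" i]
    by (simp add: bracket_Euler_partial p0) (simp add: W_scale_def fun_eq_iff)
  then have t_partial: "W_bracket (partial i) ?t = 0" for i
    by (simp only: W_bracket_minus[of "partial i"]) simp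
  have t_H: "W_bracket height_field ?t = 0"
    using lie_derivation_bracket[OF d height_field_in_W weighted_Euler_in_W, of \<mu>]
    by (simp add: H0 lie_derivation_zero[OF d]) (simp add: height_field_def bracket_Euler_Euler lie_derivation_zero[OF d])
  \<comment> \<open>Commuting with all \<open>\<partial>_i\<close> leaves only constant
    coefficients, and on these the bracket with \<open>H\<close> acts by the nonzero scalars
    \<open>-(k + 1)\<close>.\<close>
  show ?thesis
  proof (rule W_coeff_eqI)
    fix k m
    show "field_coeff ?t k m = field_coeff 0 k m"
    proof (cases "m = 0")
      case True
      then show ?thesis
        using field_coeff_bracket_height[OF tW, of k 0] by (simp add: t_H del: of_nat_Suc)
    next
      case False
      then obtain i where i: "i \<in> keys m" using keys_eq_empty by blast
      show ?thesis
        using field_coeff_bracket_partial[OF tW, of i k "m - Poly_Mapping.single i 1"]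
        by (simp only: minus_single_add_single[OF i] t_partial) (simp del: of_nat_Suc)
    qed
  qed (simp_all add: tW)
qed

lemma derivation_const_coeff_zero:
  fixes d :: "('k::field_char_0 polys \<Rightarrow> 'k polys) \<Rightarrow> ('k polys \<Rightarrow> 'k polys)"
  assumes d: "lie_derivation d" and T0: "\<And>\<mu>. d (weighted_Euler \<mu>) = 0"
    and p0: "\<And>i. d (partial i) = 0" and x: "x \<in> W"
  shows "field_coeff (d x) k 0 = 0"
proof -
  \<comment> \<open>\<open>d\<close> commutes with bracketing by a diagonal field, whose eigenvalue
    at the constant monomial is \<open>- \<mu> k\<close>.\<close>
  have d_T: "field_coeff (d (W_bracket (weighted_Euler \<mu>) z)) k 0 = - \<mu> k * field_coeff (d z) k 0"
    if "z \<in> W" for z \<mu>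
    using that lie_derivation_closed[OF d that]
    by (simp add: lie_derivation_bracket[OF d weighted_Euler_in_W] T0 field_coeff_bracket_Euler)
  \<comment> \<open>Bracketing with \<open>E\<close> multiplies by degree minus one, so adding
    \<open>y\<close> back leaves the degree as the factor to invert. Linear fields, which
    \<open>E\<close> annihilates, thus cause no division by zero; \<open>inverse 0 = 0\<close>
    leaves the constant part to \<open>c\<close>.\<close>
  define c where "c = rescale (\<lambda>k m. 1 when m = 0) x"
  define y where "y = rescale (\<lambda>k m. inverse (weight (\<lambda>_. 1) m)) x"
  have cW: "c \<in> W" and yW: "y \<in> W" by (simp_all add: c_def y_def)
  have EyW: "W_bracket (weighted_Euler (\<lambda>_. 1)) y \<in> W"
    by (simp add: W_bracket_closed yW)
  have degree_nonzero: "weight (\<lambda>_. 1) m \<noteq> (0::'k)" if "m \<noteq> 0" for m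
  proof -
    obtain i where "i \<in> keys m" using \<open>m \<noteq> 0\<close> keys_eq_empty by blast
    then have "(\<Sum>i\<in>keys m. lookup m i) \<noteq> 0"
      by (auto simp: in_keys_iff)
    then have "of_nat (\<Sum>i\<in>keys m. lookup m i) \<noteq> (0::'k)" by (simp only: of_nat_eq_0_iff) simp
    then show ?thesis by (simp add: weight_def)
  qed
  have "x = c + (W_bracket (weighted_Euler (\<lambda>_. 1)) y + y)"
  proof (rule W_coeff_eqI)
    fix k m
    show "field_coeff x k m = field_coeff (c + (W_bracket (weighted_Euler (\<lambda>_. 1)) y + y)) k m"
      using degree_nonzero[of m]
      by (cases "m = 0")
        (simp_all add: lookup_add field_coeff_bracket_Euler yW, simp_all add: c_def y_def field_coeff_rescale left_diff_distrib)
  qed (simp_all add: x cW yW EyW W_add_closed)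
  then have "field_coeff (d x) k 0 = field_coeff (d c + (d (W_bracket (weighted_Euler (\<lambda>_. 1)) y) + d y)) k 0"
    using lie_derivation_add[OF d cW, of "W_bracket (weighted_Euler (\<lambda>_. 1)) y + y"]
      lie_derivation_add[OF d EyW yW] by (simp add: W_add_closed EyW yW)
  \<comment> \<open>With all weights \<open>1\<close>, \<open>d_T\<close> yields minus the
    coefficient of \<open>d y\<close>, which cancels.\<close>
  also have "\<dots> = field_coeff (d c) k 0"
    by (simp add: lookup_add d_T yW)
  also have "\<dots> = 0"
  proof -
    \<comment> \<open>Bracketing with \<open>x_k \<partial>_k\<close> isolates one summand of the
      possibly infinite constant field \<open>c\<close>, a multiple of
      \<open>\<partial>_k\<close>.\<close>
    have "W_bracket (weighted_Euler (\<lambda>j. 1 when j = k)) c = W_scale (- field_coeff x k 0) (partial k)"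
    proof (rule W_coeff_eqI)
      fix j m
      show "field_coeff (W_bracket (weighted_Euler (\<lambda>j. 1 when j = k)) c) j m
          = field_coeff (W_scale (- field_coeff x k 0) (partial k)) j m"
        by (cases "m = 0"; cases "j = k")
          (simp_all add: field_coeff_bracket_Euler cW W_scale_def field_coeff_partial,
            simp_all add: c_def field_coeff_rescale)
    qed (simp_all add: cW W_bracket_closed W_scale_closed)
    then have "d (W_bracket (weighted_Euler (\<lambda>j. 1 when j = k)) c) = 0"
      by (simp add: lie_derivation_scale[OF d partial_in_W] p0) (simp add: W_scale_def fun_eq_iff)
    then show ?thesis
      using d_T[OF cW, of "\<lambda>j. 1 when j = k"] by simp
  qed
  finally show ?thesis .
qed

lemma derivation_eq_zero:
  fixes d :: "('k::field_char_0 polys \<Rightarrow> 'k polys) \<Rightarrow> ('k polys \<Rightarrow> 'k polys)"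
  assumes d: "lie_derivation d" and H0: "d height_field = 0" and p0: "\<And>i. d (partial i) = 0"
    and x: "x \<in> W"
  shows "d x = 0"
proof (rule W_coeff_eqI)
  fix k m
  have "field_coeff (d x) k m = 0"
    using x
  \<comment> \<open>The field \<open>x\<close> must vary: removing \<open>x_i\<close> from
    \<open>m\<close> replaces \<open>x\<close> by \<open>[\<partial>_i, x]\<close>. The weight
    serves only as a decreasing measure.\<close>
  proof (induction "weight Suc m" arbitrary: m x rule: less_induct)
    case less
    have dxW: "d x \<in> W" by (rule lie_derivation_closed[OF d less.prems])
    show ?case
    proof (cases "m = 0")
      case True
      show ?thesis
        unfolding True
        by (rule derivation_const_coeff_zero[OF d _ p0 less.prems])
          (rule derivation_weighted_Euler_zero[OF d H0 p0])
    next
      case False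
      then obtain i where i: "i \<in> keys m" using keys_eq_empty by blast
      define n where "n = m - Poly_Mapping.single i 1"
      have m: "m = n + Poly_Mapping.single i 1"
        unfolding n_def by (rule minus_single_add_single[OF i, symmetric])
      have "W_bracket (partial i) (d x) = d (W_bracket (partial i) x)"
        by (simp add: lie_derivation_bracket[OF d partial_in_W less.prems] p0 less.prems)
      moreover have "field_coeff (d (W_bracket (partial i) x)) k n = 0"
        by (rule less.hyps) (simp_all add: m weight_add W_bracket_closed less.prems)
      ultimately show ?thesis
        using field_coeff_bracket_partial[OF dxW, of i k n]
        by (simp add: m del: of_nat_Suc)
    qed
  qed
  then show "field_coeff (d x) k m = field_coeff 0 k m" by simp
qed (simp_all add: lie_derivation_closed[OF d x])

theorem theorem3:
  fixes d :: "('k::field_char_0 polys \<Rightarrow> 'k polys) \<Rightarrow> ('k polys \<Rightarrow> 'k polys)"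
  assumes "derivation_on W_scale W_bracket W d"
  shows "\<exists>a\<in>W. \<forall>x\<in>W. d x = W_bracket x a"
proof -
  obtain a where a: "a \<in> W" "d height_field = W_bracket height_field a"
    using derivation_height_inner[OF assms] by blast
  define e where "e = (\<lambda>x. d x - W_bracket x a)"
  have e: "lie_derivation e"
    unfolding e_def by (rule lie_derivation_minus_inner[OF assms a(1)])
  have eH: "e height_field = 0" by (simp add: e_def a(2))
  obtain b where b: "b \<in> W" "W_bracket height_field b = 0" "\<And>i. e (partial i) = W_bracket (partial i) b"
    using derivation_partials_inner[OF e eH] by blast
  define f where "f = (\<lambda>x. e x - W_bracket x b)"
  have f: "lie_derivation f"
    unfolding f_def by (rule lie_derivation_minus_inner[OF e b(1)])
  \<comment> \<open>That \<open>f\<close> still kills \<open>H\<close> uses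
    \<open>[H, b] = 0\<close>.\<close>
  have f0: "f x = 0" if "x \<in> W" for x
    by (rule derivation_eq_zero[OF f _ _ that]) (simp_all add: f_def eH b)
  have "d x = W_bracket x (a + b)" if x: "x \<in> W" for x
  proof -
    have "d x = W_bracket x a + W_bracket x b"
      using f0[OF x] by (simp add: f_def e_def algebra_simps)
    also have "\<dots> = W_bracket x (a + b)"
      by (rule ext) (simp add: W_bracket_def W_add[OF x])
    finally show ?thesis .
  qed
  then show ?thesis using W_add_closed[OF a(1) b(1)] by blast
qed

end
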